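(* Let $G=([d],E,B)$ be a $k$-th-order mixed graph whose directed part contains all self-loops, let $M$ be a stable $d\times d$ matrix and $\mathcal{C}$ a $k$-th-order tensor such that $(M,\mathcal{C})$ is compatible with $G$, and let $\Lambda=M+I_{d\times d}$. If $\Lambda$ has spectral radius strictly less than $1$, then the solution $\mathcal{K}$ of the $k$-th-order continuous Lyapunov equation $\mathcal{K}\times_1M+\cdots+\mathcal{K}\times_kM+\mathcal{C}=0$ satisfies, for all $i_1,\dots,i_k\in[d]$, $$\mathcal{K}_{i_1\dots i_k}=\sum_{\tau\in\mathcal{T}(i_1,\dots,i_k)}\omega(\Lambda,\mathcal{C},\tau)\,\frac{k^{-\sum_{j=1}^k\ell_{i_j}(\tau)-1}\,\Gamma\left(\sum_{j=1}^k\ell_{i_j}(\tau)+1\right)}{\prod_{j=1}^k\ell_{i_j}(\tau)!}.$$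
   Context: A $k$-th-order mixed graph $G=([d],E,B)$ has node set $[d]=\{1,\dots,d\}$, a set $E$ of directed edges (self-loops allowed) and a set $B$ of $k$-fold blunt edges, i.e. unordered $k$-tuples (multisets) of nodes; we write $(j_1,\dots,j_k)\in B$ irrespective of order. $(M,\mathcal{C})$ is compatible with $G$ if $M\in\mathbb{R}^{d\times d}$ satisfies $M_{ij}=0$ whenever $j\to i\notin E$, and $\mathcal{C}$ is a symmetric $k$-th-order $d\times\cdots\times d$ tensor with $\mathcal{C}_{j_1\cdots j_k}=0$ whenever $(j_1,\dots,j_k)\notin B$. Stable means all eigenvalues have negative real part. $(T\times_nN)_{\dots j\dots}=\sum_{i_n}T_{\dots i_n\dots}N_{ji_n}$ is the $n$-mode product. A $k$-trek $\tau$ between (positions) $i_1,\dots,i_k$ consists of an ordered tuple of top nodes $(j_1,\dots,j_k)$ forming a blunt edge in $B$ together with directed walks $\pi_m$ in $([d],E)$ from $j_m$ to $i_m$, $m=1,\dots,k$; walks may have length $0$ and may use self-loops and repeat edges. $\ell_{i_m}(\tau)$ is the length of $\pi_m$, and $\mathcal{T}(i_1,\dots,i_k)$ is the set of all such treks. The trek polynomial is $\omega(\Lambda,\mathcal{C},\tau)=\mathcal{C}_{j_1\cdots j_k}\prod_{m=1}^k\prod_{\alpha\to\beta\in\pi_m}\Lambda_{\beta\alpha}$. The infinite sum over treks is understood as the sum over all lengths $(n_1,\dots,n_k)\in\mathbb{Z}_{\ge0}^k$ of the finite sums over treks with $\ell_{i_m}(\tau)=n_m$, $m=1,\dots,k$.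 *)

theory Defs
  imports
    "HOL-Analysis.Analysis"
    "HOL-Combinatorics.Permutations"
    "Jordan_Normal_Form.Spectral_Radius"
    "Graph_Theory.Pair_Digraph"
begin

text \<open>
  The nodes are \<open>{..<d}\<close>, matching the 0-based entries of
  \<^typ>\<open>real mat\<close>; likewise the positions of a multi-index are \<open>0, ..., k - 1\<close>.
\<close>

record mixed_graph =
  directed :: "nat pair_pre_digraph"
  blunt :: "nat multiset set"

definition is_mixed_graph :: "nat \<Rightarrow> nat \<Rightarrow> mixed_graph \<Rightarrow> bool" where
  "is_mixed_graph d k G \<longleftrightarrow>
     pair_wf_digraph (directed G) \<and> pverts (directed G) = {..<d} \<and>
     (\<forall>b\<in>blunt G. size b = k \<and> set_mset b \<subseteq> {..<d})"

text \<open>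
  A tensor of order \<open>k\<close> with all dimensions \<open>d\<close> is a function on lists, of which only
  the values on \<open>multi_indices d k\<close> are ever relevant.
\<close>

type_synonym tensor = "nat list \<Rightarrow> real"

definition multi_indices :: "nat \<Rightarrow> nat \<Rightarrow> nat list set" where
  "multi_indices d k = {is. length is = k \<and> set is \<subseteq> {..<d}}"

definition symmetric_tensor :: "nat \<Rightarrow> nat \<Rightarrow> tensor \<Rightarrow> bool" where
  "symmetric_tensor d k T \<longleftrightarrow>
     (\<forall>is\<in>multi_indices d k. \<forall>\<sigma>. \<sigma> permutes {..<k} \<longrightarrow> T (permute_list \<sigma> is) = T is)"

definition mode_product :: "nat \<Rightarrow> tensor \<Rightarrow> nat \<Rightarrow> real mat \<Rightarrow> tensor" where
  "mode_product d T n N = (\<lambda>js. \<Sum>i<d. T (js[n := i]) * N $$ (js ! n, i))"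

definition compatible :: "nat \<Rightarrow> nat \<Rightarrow> mixed_graph \<Rightarrow> real mat \<Rightarrow> tensor \<Rightarrow> bool" where
  "compatible d k G M C \<longleftrightarrow>
     M \<in> carrier_mat d d \<and>
     (\<forall>i<d. \<forall>j<d. (j, i) \<notin> parcs (directed G) \<longrightarrow> M $$ (i, j) = 0) \<and>
     symmetric_tensor d k C \<and>
     (\<forall>js\<in>multi_indices d k. mset js \<notin> blunt G \<longrightarrow> C js = 0)"

definition stable_matrix :: "real mat \<Rightarrow> bool" where
  "stable_matrix M \<longleftrightarrow> (\<forall>z. eigenvalue (map_mat complex_of_real M) z \<longrightarrow> Re z < 0)"

definition lyapunov_solution :: "nat \<Rightarrow> nat \<Rightarrow> real mat \<Rightarrow> tensor \<Rightarrow> tensor \<Rightarrow> bool" where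
  "lyapunov_solution d k M C K \<longleftrightarrow>
     (\<forall>is\<in>multi_indices d k. (\<Sum>n<k. mode_product d K n M is) + C is = 0)"

text \<open>
  A trek is the list of its top nodes together with the list of its directed walks,
  each walk being the list of its arcs \<open>(\<alpha>, \<beta>)\<close>.
\<close>

type_synonym trek = "nat list \<times> (nat \<times> nat) list list"

definition treks :: "mixed_graph \<Rightarrow> nat list \<Rightarrow> trek set" where
  "treks G is = {(js, ps).
     length js = length is \<and> length ps = length is \<and> mset js \<in> blunt G \<and>
     (\<forall>m<length is. pre_digraph.awalk (with_proj (directed G)) (js ! m) (ps ! m) (is ! m))}"

definition trek_length :: "trek \<Rightarrow> nat \<Rightarrow> nat" where
  "trek_length \<tau> m = length (snd \<tau> ! m)"

definition trek_polynomial :: "real mat \<Rightarrow> tensor \<Rightarrow> trek \<Rightarrow> real" where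
  "trek_polynomial L C \<tau> =
     C (fst \<tau>) * (\<Prod>m<length (snd \<tau>). \<Prod>(\<alpha>, \<beta>)\<leftarrow>snd \<tau> ! m. L $$ (\<beta>, \<alpha>))"

end

theory Submission
  imports Defs
begin

text \<open>
  Write \<open>S T\<close> for the sum over the modes \<open>m < k\<close> of the products of a tensor \<open>T\<close> with
  \<open>\<Lambda>\<close> in mode \<open>m\<close>. Since \<open>M = \<Lambda> - I\<close>, the Lyapunov equation says \<open>k K = S K + C\<close>
  (\<open>lyapunov_solution_iff\<close>). Iterating it (\<open>fixed_point_expansion\<close>) gives
  \<open>K = (\<Sum>N<n. S^N C / k^(N+1)) + S^n K / k^n\<close>.

  Multiplications in different modes commute, so the multinomial theorem (\<open>mode_sum_power\<close>)
  expands \<open>S^N C\<close> as the sum, over the tuples \<open>ns\<close> of \<open>k\<close> natural numbers with total \<open>N\<close>, of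
  \<open>N! / (\<Prod>m. ns m !)\<close> times the tensor obtained from \<open>C\<close> by multiplying with \<open>\<Lambda>^(ns m)\<close> in
  each mode \<open>m\<close>. The spectral radius being below one, the entries of \<open>\<Lambda>^n\<close> are at most \<open>c r^n\<close>
  for some \<open>r < 1\<close> (\<open>spectral_radius_less_1_geometric_bound\<close>); as the multinomial coefficients of
  total \<open>N\<close> add up to \<open>k^N\<close>, the entries of \<open>S^N T / k^N\<close> are \<open>O(r^N)\<close> for every tensor \<open>T\<close>.
  Hence the remainder vanishes, the expansion of any solution converges absolutely as a sum over
  \<open>ns\<close> (\<open>fixed_point_has_sum\<close>), and the same series defines a solution (\<open>fixed_point_exists\<close>).

  Finally, the \<open>(i, j)\<close> entry of \<open>\<Lambda>^n\<close> is the sum over the walks of length \<open>n\<close> from \<open>j\<close> to \<open>i\<close>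
  of the products of the arc weights (\<open>finite_walks_sum\<close>); self-loops are needed here because the
  diagonal of \<open>\<Lambda>\<close> need not vanish where that of \<open>M\<close> does. Taking products over the modes, the
  multi-mode product belonging to \<open>ns\<close> is the sum of the trek polynomials over the treks with
  walk lengths \<open>ns\<close> (\<open>sum_trek_polynomial\<close>).
\<close>

section \<open>Powers of a matrix of spectral radius below one\<close>

lemma smult_mat_mult_vec:
  fixes A :: "'a::comm_ring_1 mat"
  assumes "A \<in> carrier_mat n n" "v \<in> carrier_vec n"
  shows "(a \<cdot>\<^sub>m A) *\<^sub>v v = a \<cdot>\<^sub>v (A *\<^sub>v v)"
  using assms by (intro eq_vecI) (auto simp: scalar_prod_def sum_distrib_left mult.assoc)

lemma pow_smult_mat:
  fixes A :: "'a::comm_ring_1 mat"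
  assumes "A \<in> carrier_mat n n"
  shows "(a \<cdot>\<^sub>m A) ^\<^sub>m k = a ^ k \<cdot>\<^sub>m (A ^\<^sub>m k)"
proof (induction k)
  case 0
  then show ?case using assms by auto
next
  case (Suc k)
  have Ak: "A ^\<^sub>m k \<in> carrier_mat n n" using assms by (rule pow_carrier_mat)
  have "(a \<cdot>\<^sub>m A) ^\<^sub>m Suc k = (a ^ k \<cdot>\<^sub>m (A ^\<^sub>m k)) * (a \<cdot>\<^sub>m A)"
    using Suc by simp
  also have "\<dots> = a ^ k \<cdot>\<^sub>m (a \<cdot>\<^sub>m (A ^\<^sub>m k * A))"
    using Ak assms mult_smult_distrib[OF Ak assms, of a]
      mult_smult_assoc_mat[OF Ak, of "a \<cdot>\<^sub>m A" n "a ^ k"] by auto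
  also have "\<dots> = a ^ Suc k \<cdot>\<^sub>m (A ^\<^sub>m Suc k)"
    using Ak assms by (intro eq_matI) (auto simp: mult_ac)
  finally show ?case .
qed

lemma pow_mat_Suc_left:
  fixes A :: "'a::comm_ring_1 mat"
  assumes "A \<in> carrier_mat n n"
  shows "A ^\<^sub>m Suc k = A * A ^\<^sub>m k"
proof (induction k)
  case 0
  then show ?case using assms by simp
next
  case (Suc k)
  have Ak: "A ^\<^sub>m k \<in> carrier_mat n n" using assms by (rule pow_carrier_mat)
  have "A ^\<^sub>m Suc (Suc k) = (A * A ^\<^sub>m k) * A" using Suc by simp
  also have "\<dots> = A * A ^\<^sub>m Suc k" using assoc_mult_mat[OF assms Ak assms] by simp
  finally show ?case .
qed

text \<open>
  A matrix of spectral radius below one has bounded powers; dividing by a number \<open>r\<close> strictly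
  between the spectral radius and one turns boundedness into geometric decay.
\<close>

lemma spectral_radius_less_1_geometric_bound:
  fixes L :: "real mat"
  assumes L: "L \<in> carrier_mat d d"
    and sr: "spectral_radius (map_mat complex_of_real L) < 1"
  obtains c r where "0 < r" "r < 1" "0 \<le> c"
    "\<And>n i j. i < d \<Longrightarrow> j < d \<Longrightarrow> \<bar>(L ^\<^sub>m n) $$ (i, j)\<bar> \<le> c * r ^ n"
proof (cases "d = 0")
  case True
  then show thesis by (intro that[of "1/2" 0]) auto
next
  case False
  define A where "A = map_mat complex_of_real L"
  have A: "A \<in> carrier_mat d d" using L by (simp add: A_def)
  have sr0: "spectral_radius A \<ge> 0"
    using spectral_radius_mem_max(1)[OF A] False by auto
  define r where "r = (spectral_radius A + 1) / 2"
  have r: "0 < r" "r < 1" "spectral_radius A < r"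
    using sr sr0 by (auto simp: r_def A_def)
  define B where "B = complex_of_real (1 / r) \<cdot>\<^sub>m A"
  have B: "B \<in> carrier_mat d d" using A by (simp add: B_def)
  obtain e where e: "eigenvalue B e" and eq: "spectral_radius B = norm e"
    using spectral_radius_mem_max(1)[OF B] False by (auto simp: spectrum_def)
  from e obtain v where v: "v \<in> carrier_vec d" "v \<noteq> 0\<^sub>v d" "B *\<^sub>v v = e \<cdot>\<^sub>v v"
    using B by (auto simp: eigenvalue_def eigenvector_def)
  have "A *\<^sub>v v = complex_of_real r \<cdot>\<^sub>v (B *\<^sub>v v)"
    unfolding B_def smult_mat_mult_vec[OF A v(1)] using r
    by (auto simp: smult_smult_assoc)
  then have "A *\<^sub>v v = (complex_of_real r * e) \<cdot>\<^sub>v v"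
    using v by (simp add: smult_smult_assoc)
  then have "eigenvalue A (complex_of_real r * e)"
    using v A by (auto simp: eigenvalue_def eigenvector_def)
  then have "norm (complex_of_real r * e) \<le> spectral_radius A"
    using spectral_radius_mem_max(2)[OF A] False by (auto simp: spectrum_def)
  then have "r * norm e \<le> spectral_radius A" using r by (simp add: norm_mult)
  then have "r * norm e < r * 1" using r by linarith
  then have "spectral_radius B < 1" unfolding eq using r(1) by (simp only: mult_less_cancel_left_pos)
  then obtain c where c: "\<And>n. norm_bound (B ^\<^sub>m n) c"
    using spectral_radius_jnf_norm_bound_less_1_upper_triangular[OF B] by auto
  have bound: "\<bar>(L ^\<^sub>m n) $$ (i, j)\<bar> \<le> max c 0 * r ^ n" if ij: "i < d" "j < d" for n i j
  proof -
    have Ln: "L ^\<^sub>m n \<in> carrier_mat d d" using L by (rule pow_carrier_mat)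
    have "B ^\<^sub>m n = complex_of_real (1 / r) ^ n \<cdot>\<^sub>m map_mat complex_of_real (L ^\<^sub>m n)"
      unfolding B_def pow_smult_mat[OF A] unfolding A_def
      by (simp add: of_real_hom.mat_hom_pow[OF L])
    then have "norm ((B ^\<^sub>m n) $$ (i, j)) = \<bar>(L ^\<^sub>m n) $$ (i, j)\<bar> / r ^ n"
      using ij L Ln r by (auto simp: norm_mult norm_power norm_divide power_one_over)
    moreover have "norm ((B ^\<^sub>m n) $$ (i, j)) \<le> c"
      using c[of n] ij B pow_carrier_mat[OF B, of n] by (auto simp: norm_bound_def)
    ultimately have "\<bar>(L ^\<^sub>m n) $$ (i, j)\<bar> \<le> c * r ^ n"
      using r by (simp add: pos_divide_le_eq)
    also have "\<dots> \<le> max c 0 * r ^ n" using r by (intro mult_right_mono) auto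
    finally show ?thesis .
  qed
  show thesis by (rule that[OF r(1,2) _ bound]) auto
qed

section \<open>Multinomial weights\<close>

text \<open>
  The weak compositions of \<open>N\<close> into \<open>k\<close> parts: parts may be zero, and their order matters.
\<close>

definition compositions :: "nat \<Rightarrow> nat \<Rightarrow> nat list set" where
  "compositions k N = {ns. length ns = k \<and> (\<Sum>m<k. ns ! m) = N}"

text \<open>
  The multinomial coefficient of the parts \<open>ns\<close>, as a real number.
\<close>

definition multinomial :: "nat list \<Rightarrow> real" where
  "multinomial ns = fact (\<Sum>m<length ns. ns ! m) / (\<Prod>m<length ns. fact (ns ! m))"

lemma finite_compositions: "finite (compositions k N)"
proof (rule finite_subset)
  show "compositions k N \<subseteq> {ns. set ns \<subseteq> {..N} \<and> length ns = k}"
    by (auto simp: compositions_def in_set_conv_nth intro: member_le_sum)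
  show "finite {ns. set ns \<subseteq> {..N} \<and> length ns = k}"
    by (rule finite_lists_length_eq) simp
qed

lemma compositions_0: "compositions k 0 = {replicate k 0}"
  by (auto simp: compositions_def intro: nth_equalityI)

lemma multinomial_pos: "multinomial ns > 0"
  unfolding multinomial_def by (intro divide_pos_pos prod_pos) auto

lemma sum_list_update_Suc:
  assumes "m < k" "length ns = k"
  shows "(\<Sum>j<k. ns[m := Suc (ns ! m)] ! j) = Suc (\<Sum>j<k. ns ! j)"
proof -
  have "(\<Sum>j<k. ns[m := Suc (ns ! m)] ! j) = (\<Sum>j<k. ns ! j + (if j = m then 1 else 0))"
    using assms by (intro sum.cong) (auto simp: nth_list_update)
  also have "\<dots> = Suc (\<Sum>j<k. ns ! j)"
    using assms by (simp add: sum.distrib)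
  finally show ?thesis .
qed

lemma multinomial_list_update_Suc:
  assumes "m < k" "ns \<in> compositions k N"
  shows "multinomial ns =
    multinomial (ns[m := Suc (ns ! m)]) * real (Suc (ns ! m)) / real (Suc N)"
proof -
  have len: "length ns = k" and N: "(\<Sum>j<k. ns ! j) = N"
    using assms by (auto simp: compositions_def)
  have "(\<Prod>j<k. fact (ns[m := Suc (ns ! m)] ! j) :: real) =
      (\<Prod>j<k. fact (ns ! j) * (if j = m then real (Suc (ns ! m)) else 1))"
    using assms len by (intro prod.cong) (auto simp: nth_list_update mult.commute)
  also have "\<dots> = (\<Prod>j<k. fact (ns ! j)) * real (Suc (ns ! m))"
    using assms by (simp add: prod.distrib)
  finally show ?thesis
    using assms(1) len N by (simp add: multinomial_def sum_list_update_Suc del: of_nat_Suc)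
qed

text \<open>
  Weighted version of the multinomial recursion: raising one part of a composition of \<open>N\<close> in
  all \<open>k\<close> possible ways yields the compositions of \<open>N + 1\<close>.
\<close>

lemma sum_multinomial_Suc:
  fixes g :: "nat list \<Rightarrow> real"
  shows "(\<Sum>m<k. \<Sum>ns\<in>compositions k N. multinomial ns * g (ns[m := Suc (ns ! m)])) =
    (\<Sum>ns\<in>compositions k (Suc N). multinomial ns * g ns)"
proof -
  \<comment> \<open>Chosen so that \<open>h m\<close> of the raised composition is the summand on the left, that \<open>h m\<close>
    vanishes on compositions that do not arise by raising part \<open>m\<close>, and that summing \<open>h m ns\<close>
    over \<open>m\<close> cancels the denominator.\<close>
  define h where "h m ns = multinomial ns * real (ns ! m) / real (Suc N) * g ns" for m ns
  have "(\<Sum>ns\<in>compositions k N. multinomial ns * g (ns[m := Suc (ns ! m)])) =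
      (\<Sum>ns\<in>compositions k (Suc N). h m ns)" if m: "m < k" for m
  proof -
    have "(\<Sum>ns\<in>compositions k N. multinomial ns * g (ns[m := Suc (ns ! m)])) =
        (\<Sum>ns\<in>compositions k N. h m (ns[m := Suc (ns ! m)]))"
    proof (rule sum.cong)
      fix ns assume ns: "ns \<in> compositions k N"
      then have "ns[m := Suc (ns ! m)] ! m = Suc (ns ! m)"
        using m by (simp add: compositions_def)
      then show "multinomial ns * g (ns[m := Suc (ns ! m)]) = h m (ns[m := Suc (ns ! m)])"
        unfolding h_def multinomial_list_update_Suc[OF m ns] by (simp only:)
    qed simp
    also have "\<dots> = (\<Sum>ns\<in>{ns \<in> compositions k (Suc N). 0 < ns ! m}. h m ns)"
    proof (rule sum.reindex_bij_witness
        [of _ "\<lambda>ns. ns[m := ns ! m - 1]" "\<lambda>ns. ns[m := Suc (ns ! m)]"])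
      fix ns assume ns: "ns \<in> {ns \<in> compositions k (Suc N). 0 < ns ! m}"
      then have len: "length ns = k" by (simp add: compositions_def)
      have eq: "ns[m := ns ! m - 1, m := Suc (ns[m := ns ! m - 1] ! m)] = ns"
        using ns m len by auto
      then show "ns[m := ns ! m - 1, m := Suc (ns[m := ns ! m - 1] ! m)] = ns" .
      have "(\<Sum>j<k. ns ! j) = Suc (\<Sum>j<k. ns[m := ns ! m - 1] ! j)"
        using sum_list_update_Suc[OF m, of "ns[m := ns ! m - 1]"] eq len by simp
      then show "ns[m := ns ! m - 1] \<in> compositions k N"
        using ns by (auto simp: compositions_def)
    qed (use m in \<open>auto simp: compositions_def sum_list_update_Suc\<close>)
    also have "\<dots> = (\<Sum>ns\<in>compositions k (Suc N). h m ns)"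
      by (intro sum.mono_neutral_left) (auto simp: finite_compositions h_def)
    finally show ?thesis .
  qed
  then have "(\<Sum>m<k. \<Sum>ns\<in>compositions k N. multinomial ns * g (ns[m := Suc (ns ! m)])) =
      (\<Sum>m<k. \<Sum>ns\<in>compositions k (Suc N). h m ns)"
    by simp
  also have "\<dots> = (\<Sum>ns\<in>compositions k (Suc N). \<Sum>m<k. h m ns)"
    by (rule sum.swap)
  also have "\<dots> = (\<Sum>ns\<in>compositions k (Suc N). multinomial ns * g ns)"
  proof (rule sum.cong)
    fix ns assume "ns \<in> compositions k (Suc N)"
    then have "(\<Sum>m<k. real (ns ! m)) = real (Suc N)"
      by (simp add: compositions_def flip: of_nat_sum)
    moreover have "(\<Sum>m<k. h m ns) =
        (\<Sum>m<k. real (ns ! m)) * (multinomial ns * g ns / real (Suc N))"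
      unfolding h_def sum_distrib_right by (intro sum.cong) auto
    ultimately show "(\<Sum>m<k. h m ns) = multinomial ns * g ns" by simp
  qed simp
  finally show ?thesis .
qed

lemma sum_multinomial: "(\<Sum>ns\<in>compositions k N. multinomial ns) = real k ^ N"
proof (induction N)
  case 0
  then show ?case by (simp add: compositions_0 multinomial_def)
next
  case (Suc N)
  then show ?case using sum_multinomial_Suc[where g = "\<lambda>_. 1" and k = k and N = N] by simp
qed

section \<open>Multilinear action of matrix powers on tensors\<close>

text \<open>
  The tensor \<open>C\<close> multiplied in each mode \<open>m < k\<close> by the power of \<open>L\<close> with exponent \<open>ns ! m\<close>,
  given by the closed formula for its entries, all modes being contracted at once.
\<close>

definition multi_mode_product ::
  "nat \<Rightarrow> nat \<Rightarrow> real mat \<Rightarrow> tensor \<Rightarrow> nat list \<Rightarrow> tensor" where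
  "multi_mode_product d k L C ns = (\<lambda>is. \<Sum>js\<in>multi_indices d k.
     C js * (\<Prod>m<k. (L ^\<^sub>m (ns ! m)) $$ (is ! m, js ! m)))"

text \<open>
  The sum of the products of \<open>T\<close> with the same matrix \<open>L\<close> in each of the \<open>k\<close> modes. Iterates of
  this operator play the role of powers of a sum of \<open>k\<close> commuting operators.
\<close>

definition mode_sum :: "nat \<Rightarrow> nat \<Rightarrow> real mat \<Rightarrow> tensor \<Rightarrow> tensor" where
  "mode_sum d k L T = (\<lambda>is. \<Sum>m<k. mode_product d T m L is)"

lemma finite_multi_indices: "finite (multi_indices d k)"
  unfolding multi_indices_def
  by (rule finite_subset[OF _ finite_lists_length_eq[of "{..<d}" k]]) auto

lemma multi_indices_nth: "is \<in> multi_indices d k \<Longrightarrow> m < k \<Longrightarrow> is ! m < d"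
  by (auto simp: multi_indices_def dest: nth_mem)

lemma multi_indices_update:
  "is \<in> multi_indices d k \<Longrightarrow> i < d \<Longrightarrow> is[m := i] \<in> multi_indices d k"
  by (auto simp: multi_indices_def dest: set_update_subset_insert[THEN subsetD])

lemma mode_sum_cong:
  assumes "\<And>is. is \<in> multi_indices d k \<Longrightarrow> T is = U is" "is \<in> multi_indices d k"
  shows "mode_sum d k L T is = mode_sum d k L U is"
  using assms by (simp add: mode_sum_def mode_product_def multi_indices_update)

lemma mode_sum_power_cong:
  assumes "\<And>is. is \<in> multi_indices d k \<Longrightarrow> T is = U is" "is \<in> multi_indices d k"
  shows "(mode_sum d k L ^^ N) T is = (mode_sum d k L ^^ N) U is"
  using assms(2)
proof (induction N arbitrary: "is")
  case 0
  then show ?case using assms(1) by simp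
next
  case (Suc N)
  then show ?case by (auto intro: mode_sum_cong)
qed

lemma mode_sum_linear:
  "mode_sum d k L (\<lambda>is. a * T is + b * U is) =
    (\<lambda>is. a * mode_sum d k L T is + b * mode_sum d k L U is)"
  by (simp add: mode_sum_def mode_product_def fun_eq_iff sum.distrib algebra_simps
      sum_distrib_left)

lemma mode_sum_power_linear:
  "(mode_sum d k L ^^ N) (\<lambda>is. a * T is + b * U is) =
    (\<lambda>is. a * (mode_sum d k L ^^ N) T is + b * (mode_sum d k L ^^ N) U is)"
  by (induction N) (simp_all add: mode_sum_linear)

lemma mode_product_multi_mode_product:
  assumes L: "L \<in> carrier_mat d d" and m: "m < k" and len: "length ns = k"
    and "is": "is \<in> multi_indices d k"
  shows "mode_product d (multi_mode_product d k L C ns) m L is =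
    multi_mode_product d k L C (ns[m := Suc (ns ! m)]) is"
proof -
  have lis: "length is = k" using "is" by (simp add: multi_indices_def)
  \<comment> \<open>Only the factor of mode \<open>m\<close> differs between the two sides.\<close>
  have split: "(\<Prod>j<k. f j) = f m * (\<Prod>j\<in>{..<k} - {m}. f j)" for f :: "nat \<Rightarrow> real"
    using m by (simp add: prod.remove)
  have "mode_product d (multi_mode_product d k L C ns) m L is =
      (\<Sum>js\<in>multi_indices d k. \<Sum>i<d.
        C js * (\<Prod>j<k. (L ^\<^sub>m (ns ! j)) $$ (is[m := i] ! j, js ! j)) * L $$ (is ! m, i))"
    unfolding mode_product_def multi_mode_product_def sum_distrib_right
    by (rule sum.swap)
  also have "\<dots> = multi_mode_product d k L C (ns[m := Suc (ns ! m)]) is"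
    unfolding multi_mode_product_def
  proof (rule sum.cong)
    fix js assume js: "js \<in> multi_indices d k"
    define R where "R = (\<Prod>j\<in>{..<k} - {m}. (L ^\<^sub>m (ns ! j)) $$ (is ! j, js ! j))"
    have lhs: "(\<Prod>j<k. (L ^\<^sub>m (ns ! j)) $$ (is[m := i] ! j, js ! j)) =
        (L ^\<^sub>m (ns ! m)) $$ (i, js ! m) * R" for i
      unfolding split R_def using m lis by (auto intro!: arg_cong2[of _ _ _ _ "(*)"] prod.cong)
    have rhs: "(\<Prod>j<k. (L ^\<^sub>m (ns[m := Suc (ns ! m)] ! j)) $$ (is ! j, js ! j)) =
        (L ^\<^sub>m Suc (ns ! m)) $$ (is ! m, js ! m) * R"
      unfolding split R_def using m len by (auto intro!: arg_cong2[of _ _ _ _ "(*)"] prod.cong)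
    have Ln: "L ^\<^sub>m (ns ! m) \<in> carrier_mat d d" using L by (rule pow_carrier_mat)
    have "(L ^\<^sub>m Suc (ns ! m)) $$ (is ! m, js ! m) =
        (\<Sum>i<d. L $$ (is ! m, i) * (L ^\<^sub>m (ns ! m)) $$ (i, js ! m))"
      using L Ln multi_indices_nth[OF "is" m] multi_indices_nth[OF js m]
      by (simp del: pow_mat.simps add: pow_mat_Suc_left[OF L] scalar_prod_def atLeast0LessThan)
    then show "(\<Sum>i<d. C js * (\<Prod>j<k. (L ^\<^sub>m (ns ! j)) $$ (is[m := i] ! j, js ! j))
          * L $$ (is ! m, i)) =
        C js * (\<Prod>j<k. (L ^\<^sub>m (ns[m := Suc (ns ! m)] ! j)) $$ (is ! j, js ! j))"
      unfolding lhs rhs by (simp add: sum_distrib_left sum_distrib_right mult_ac)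
  qed simp
  finally show ?thesis .
qed

lemma multi_mode_product_replicate_0:
  assumes L: "L \<in> carrier_mat d d" and "is": "is \<in> multi_indices d k"
  shows "multi_mode_product d k L C (replicate k 0) is = C is"
proof -
  have "C js * (\<Prod>m<k. (L ^\<^sub>m (replicate k 0 ! m)) $$ (is ! m, js ! m)) =
      (if js = is then C js else 0)" if js: "js \<in> multi_indices d k" for js
  proof -
    have eq: "(L ^\<^sub>m (replicate k 0 ! m)) $$ (is ! m, js ! m) = (if is ! m = js ! m then 1 else 0)"
      if "m < k" for m
      using that L multi_indices_nth[OF "is" that] multi_indices_nth[OF js that] by simp
    show ?thesis
    proof (cases "js = is")
      case True
      then show ?thesis using eq by simp
    next
      case False
      then obtain m where "m < k" "is ! m \<noteq> js ! m"
        using "is" js by (auto simp: multi_indices_def list_eq_iff_nth_eq)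
      then have "(\<Prod>m<k. (L ^\<^sub>m (replicate k 0 ! m)) $$ (is ! m, js ! m)) = 0"
        using eq[of m] by (auto intro!: prod_zero)
      then show ?thesis using False by simp
    qed
  qed
  then show ?thesis using "is" by (simp add: multi_mode_product_def finite_multi_indices)
qed

text \<open>
  The multinomial theorem for \<open>mode_sum\<close>. Multiplications by \<open>L\<close> in different modes commute,
  which is implicit in the fact that one more of them just raises one exponent of the multi-mode
  product.
\<close>

lemma mode_sum_power:
  assumes L: "L \<in> carrier_mat d d" and "is": "is \<in> multi_indices d k"
  shows "(mode_sum d k L ^^ N) C is =
    (\<Sum>ns\<in>compositions k N. multinomial ns * multi_mode_product d k L C ns is)"
  using "is"
proof (induction N arbitrary: "is")
  case 0
  then show ?case
    using multi_mode_product_replicate_0[OF L, of "is" k C]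
    by (simp add: compositions_0 multinomial_def)
next
  case (Suc N)
  let ?P = "multi_mode_product d k L C"
  have "(mode_sum d k L ^^ Suc N) C is =
      mode_sum d k L (\<lambda>is. \<Sum>ns\<in>compositions k N. multinomial ns * ?P ns is) is"
    using Suc by (auto intro: mode_sum_cong)
  also have "\<dots> = (\<Sum>m<k. \<Sum>ns\<in>compositions k N. multinomial ns * mode_product d (?P ns) m L is)"
    unfolding mode_sum_def mode_product_def sum_distrib_right sum_distrib_left mult.assoc
    by (intro sum.cong refl sum.swap)
  also have "\<dots> = (\<Sum>m<k. \<Sum>ns\<in>compositions k N.
      multinomial ns * ?P (ns[m := Suc (ns ! m)]) is)"
    using mode_product_multi_mode_product[OF L] Suc.prems
    by (intro sum.cong) (auto simp: compositions_def)
  also have "\<dots> = (\<Sum>ns\<in>compositions k (Suc N). multinomial ns * ?P ns is)"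
    by (rule sum_multinomial_Suc)
  finally show ?case .
qed

lemma abs_multi_mode_product_le:
  assumes bound: "\<And>n i j. i < d \<Longrightarrow> j < d \<Longrightarrow> \<bar>(L ^\<^sub>m n) $$ (i, j)\<bar> \<le> c * r ^ n"
    and "is": "is \<in> multi_indices d k" and ns: "ns \<in> compositions k N"
  shows "\<bar>multi_mode_product d k L C ns is\<bar> \<le> (\<Sum>js\<in>multi_indices d k. \<bar>C js\<bar>) * c ^ k * r ^ N"
proof -
  have "\<bar>multi_mode_product d k L C ns is\<bar> \<le> (\<Sum>js\<in>multi_indices d k.
      \<bar>C js * (\<Prod>m<k. (L ^\<^sub>m (ns ! m)) $$ (is ! m, js ! m))\<bar>)"
    unfolding multi_mode_product_def by (rule sum_abs)
  also have "\<dots> \<le> (\<Sum>js\<in>multi_indices d k. \<bar>C js\<bar> * (c ^ k * r ^ N))"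
  proof (rule sum_mono)
    fix js assume js: "js \<in> multi_indices d k"
    have "(\<Prod>m<k. \<bar>(L ^\<^sub>m (ns ! m)) $$ (is ! m, js ! m)\<bar>) \<le> (\<Prod>m<k. c * r ^ (ns ! m))"
      using multi_indices_nth[OF "is"] multi_indices_nth[OF js]
      by (intro prod_mono) (auto intro: bound)
    also have "\<dots> = c ^ k * r ^ N"
      using ns by (simp add: compositions_def prod.distrib flip: power_sum)
    finally show "\<bar>C js * (\<Prod>m<k. (L ^\<^sub>m (ns ! m)) $$ (is ! m, js ! m))\<bar>
        \<le> \<bar>C js\<bar> * (c ^ k * r ^ N)"
      by (simp add: abs_mult abs_prod mult_left_mono)
  qed
  finally show ?thesis by (simp add: sum_distrib_right mult.assoc)
qed

lemma sum_abs_multi_mode_product_le: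
  assumes bound: "\<And>n i j. i < d \<Longrightarrow> j < d \<Longrightarrow> \<bar>(L ^\<^sub>m n) $$ (i, j)\<bar> \<le> c * r ^ n"
    and "is": "is \<in> multi_indices d k"
  shows "(\<Sum>ns\<in>compositions k N. \<bar>multinomial ns * multi_mode_product d k L C ns is\<bar>)
    \<le> (\<Sum>js\<in>multi_indices d k. \<bar>C js\<bar>) * c ^ k * r ^ N * real k ^ N"
proof -
  have "(\<Sum>ns\<in>compositions k N. \<bar>multinomial ns * multi_mode_product d k L C ns is\<bar>)
    \<le> (\<Sum>ns\<in>compositions k N.
        multinomial ns * ((\<Sum>js\<in>multi_indices d k. \<bar>C js\<bar>) * c ^ k * r ^ N))"
    using abs_multi_mode_product_le[OF bound "is"]
    by (intro sum_mono)
      (auto simp: abs_mult multinomial_pos less_imp_le mult.assoc intro!: mult_left_mono)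
  also have "\<dots> = (\<Sum>js\<in>multi_indices d k. \<bar>C js\<bar>) * c ^ k * r ^ N * real k ^ N"
    by (simp flip: sum_distrib_right sum_multinomial)
  finally show ?thesis .
qed

section \<open>The Lyapunov equation as a fixed-point equation\<close>

lemma lyapunov_solution_iff:
  assumes M: "M \<in> carrier_mat d d" and L: "L = M + 1\<^sub>m d"
  shows "lyapunov_solution d k M C K \<longleftrightarrow>
    (\<forall>is\<in>multi_indices d k. real k * K is = mode_sum d k L K is + C is)"
proof -
  have "(\<Sum>n<k. mode_product d K n M is) = mode_sum d k L K is - real k * K is"
    if "is": "is \<in> multi_indices d k" for "is"
  proof -
    have "mode_product d K n L is = mode_product d K n M is + K is" if n: "n < k" for n
    proof -
      have i: "is ! n < d" using multi_indices_nth[OF "is" n] .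
      have "mode_product d K n L is =
          (\<Sum>i<d. K (is[n := i]) * M $$ (is ! n, i) + (if i = is ! n then K is else 0))"
        unfolding mode_product_def using i M L
        by (intro sum.cong) (auto simp: algebra_simps)
      then show ?thesis using i by (simp add: sum.distrib mode_product_def)
    qed
    then show ?thesis by (simp add: mode_sum_def sum.distrib)
  qed
  then have "(\<Sum>n<k. mode_product d K n M is) + C is = 0 \<longleftrightarrow>
      real k * K is = mode_sum d k L K is + C is" if "is \<in> multi_indices d k" for "is"
    using that by fastforce
  then show ?thesis by (simp add: lyapunov_solution_def)
qed

text \<open>
  The first \<open>n\<close> steps of the iteration of \<open>K = (S K + C) / k\<close>, with remainder.
\<close>

lemma fixed_point_expansion:
  assumes k: "k \<ge> 1"
    and K: "\<And>is. is \<in> multi_indices d k \<Longrightarrow> real k * K is = mode_sum d k L K is + C is"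
    and "is": "is \<in> multi_indices d k"
  shows "K is = (\<Sum>N<n. (mode_sum d k L ^^ N) C is / real k ^ Suc N)
    + (mode_sum d k L ^^ n) K is / real k ^ n"
proof (induction n)
  case 0
  then show ?case by simp
next
  case (Suc n)
  let ?S = "mode_sum d k L"
  have "(?S ^^ n) K is = (?S ^^ n) (\<lambda>is. (1 / real k) * ?S K is + (1 / real k) * C is) is"
  proof (rule mode_sum_power_cong[OF _ "is"])
    fix js assume "js \<in> multi_indices d k"
    from K[OF this] k show "K js = (1 / real k) * ?S K js + (1 / real k) * C js"
      by (simp add: field_simps)
  qed
  also have "\<dots> = ((?S ^^ Suc n) K is + (?S ^^ n) C is) / real k"
    unfolding mode_sum_power_linear funpow_Suc_right by (simp add: add_divide_distrib)
  finally show ?case using Suc by (simp add: add_divide_distrib mult.commute)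
qed

lemma fixed_point_sums:
  assumes k: "k \<ge> 1" and L: "L \<in> carrier_mat d d"
    and r: "0 < r" "r < 1"
    and bound: "\<And>n i j. i < d \<Longrightarrow> j < d \<Longrightarrow> \<bar>(L ^\<^sub>m n) $$ (i, j)\<bar> \<le> c * r ^ n"
    and K: "\<And>is. is \<in> multi_indices d k \<Longrightarrow> real k * K is = mode_sum d k L K is + C is"
    and "is": "is \<in> multi_indices d k"
  shows "(\<lambda>N. (mode_sum d k L ^^ N) C is / real k ^ Suc N) sums K is"
proof -
  define B where "B = (\<Sum>js\<in>multi_indices d k. \<bar>K js\<bar>) * c ^ k"
  have "\<bar>(mode_sum d k L ^^ n) K is / real k ^ n\<bar> \<le> B * r ^ n" for n
  proof -
    have "\<bar>(mode_sum d k L ^^ n) K is\<bar> \<le> B * r ^ n * real k ^ n"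
      unfolding mode_sum_power[OF L "is"] B_def
      by (rule order_trans[OF sum_abs sum_abs_multi_mode_product_le[OF bound "is"]])
    then show ?thesis using k by (simp add: abs_divide pos_divide_le_eq)
  qed
  then have "\<forall>\<^sub>F n in sequentially.
      norm ((mode_sum d k L ^^ n) K is / real k ^ n) \<le> B * r ^ n"
    by simp
  moreover have "(\<lambda>n. B * r ^ n) \<longlonglongrightarrow> 0"
    using r by (intro tendsto_mult_right_zero LIMSEQ_realpow_zero) auto
  ultimately have "(\<lambda>n. (mode_sum d k L ^^ n) K is / real k ^ n) \<longlonglongrightarrow> 0"
    by (rule Lim_null_comparison)
  then have "(\<lambda>n. K is - (mode_sum d k L ^^ n) K is / real k ^ n) \<longlonglongrightarrow> K is - 0"
    by (intro tendsto_intros)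
  moreover have "(\<lambda>n. K is - (mode_sum d k L ^^ n) K is / real k ^ n) =
      (\<lambda>n. \<Sum>N<n. (mode_sum d k L ^^ N) C is / real k ^ Suc N)"
  proof
    fix n
    show "K is - (mode_sum d k L ^^ n) K is / real k ^ n =
        (\<Sum>N<n. (mode_sum d k L ^^ N) C is / real k ^ Suc N)"
      using fixed_point_expansion[OF k K "is", of n] by linarith
  qed
  ultimately show ?thesis by (simp add: sums_def)
qed

lemma fixed_point_exists:
  assumes k: "k \<ge> 1" and L: "L \<in> carrier_mat d d"
    and r: "0 < r" "r < 1"
    and bound: "\<And>n i j. i < d \<Longrightarrow> j < d \<Longrightarrow> \<bar>(L ^\<^sub>m n) $$ (i, j)\<bar> \<le> c * r ^ n"
  obtains K where
    "\<And>is. is \<in> multi_indices d k \<Longrightarrow> real k * K is = mode_sum d k L K is + C is"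
proof
  let ?S = "mode_sum d k L"
  define f where "f is N = (?S ^^ N) C is / real k ^ Suc N" for "is" N
  \<comment> \<open>Applying \<open>S\<close> to the series shifts it by one term, up to the factor \<open>k\<close>.\<close>
  define K where "K is = (\<Sum>N. f is N)" for "is"
  define B where "B = (\<Sum>js\<in>multi_indices d k. \<bar>C js\<bar>) * c ^ k"
  have sums: "f is sums K is" if "is": "is \<in> multi_indices d k" for "is"
  proof -
    have le: "norm (f is N) \<le> B / real k * r ^ N" for N
    proof -
      have "\<bar>(?S ^^ N) C is\<bar> \<le> B * r ^ N * real k ^ N"
        unfolding mode_sum_power[OF L "is"] B_def
        by (rule order_trans[OF sum_abs sum_abs_multi_mode_product_le[OF bound "is"]])
      then show ?thesis using k by (simp add: f_def abs_mult field_simps)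
    qed
    have "summable (\<lambda>N. B / real k * r ^ N)"
      using r by (intro summable_mult summable_geometric) auto
    then have "summable (f is)"
      using le by (rule summable_comparison_test')
    then show ?thesis by (simp add: K_def summable_sums)
  qed
  fix "is" assume "is": "is \<in> multi_indices d k"
  have "(\<lambda>N. ?S (\<lambda>js. f js N) is) sums ?S K is"
    unfolding mode_sum_def mode_product_def
    using multi_indices_update[OF "is"] by (intro sums_sum sums_mult2 sums) auto
  moreover have "?S (\<lambda>js. f js N) is = real k * f is (Suc N)" for N
    using mode_sum_linear[of d k L "1 / real k ^ Suc N" "(?S ^^ N) C" 0 "\<lambda>_. 0"] k
    by (simp add: f_def fun_eq_iff)
  ultimately have "(\<lambda>N. real k * f is (Suc N)) sums ?S K is" by simp
  moreover have "(\<lambda>N. real k * f is (Suc N)) sums (real k * (K is - f is 0))"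
    using sums[OF "is"] by (intro sums_mult) (simp add: sums_Suc_iff)
  ultimately have "?S K is = real k * (K is - f is 0)" by (rule sums_unique2)
  then show "real k * K is = ?S K is + C is"
    using k by (simp add: f_def algebra_simps)
qed

text \<open>
  Passage from a series grouped by degree to an unordered sum: it suffices that the sums of
  absolute values over the finite sets of elements of degree \<open>N\<close> have a summable bound.
\<close>

lemma has_sum_graded:
  fixes f :: "'a \<Rightarrow> real" and A :: "nat \<Rightarrow> 'a set"
  assumes fin: "\<And>N. finite (A N)" and disj: "\<And>N N'. N \<noteq> N' \<Longrightarrow> A N \<inter> A N' = {}"
    and bound: "\<And>N. (\<Sum>x\<in>A N. \<bar>f x\<bar>) \<le> b N" and b: "summable b"
    and sums: "(\<lambda>N. \<Sum>x\<in>A N. f x) sums s"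
  shows "(f has_sum s) (\<Union>N. A N)"
proof -
  have inj: "inj_on snd (Sigma UNIV A)"
    using disj by (auto simp: inj_on_def)
  have img: "snd ` Sigma UNIV A = (\<Union>N. A N)" by force
  have "(\<lambda>p. f (snd p)) summable_on Sigma UNIV A"
  proof (rule abs_summable_summable, rule nonneg_bdd_above_summable_on)
    show "bdd_above (sum (\<lambda>p. norm (f (snd p))) ` {F. F \<subseteq> Sigma UNIV A \<and> finite F})"
    proof (rule bdd_aboveI2)
      fix F assume F: "F \<in> {F. F \<subseteq> Sigma UNIV A \<and> finite F}"
      have nonneg: "0 \<le> b N" for N
        using bound[of N] by (rule order_trans[rotated]) (simp add: sum_nonneg)
      have "sum (\<lambda>p. norm (f (snd p))) F \<le> sum (\<lambda>p. norm (f (snd p))) (Sigma (fst ` F) A)"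
        using F fin by (intro sum_mono2) force+
      also have "\<dots> = (\<Sum>N\<in>fst ` F. \<Sum>x\<in>A N. \<bar>f x\<bar>)"
        using F fin by (subst sum.Sigma) (auto simp: case_prod_unfold)
      also have "\<dots> \<le> sum b (fst ` F)" using bound by (rule sum_mono)
      also have "\<dots> \<le> suminf b" using b F nonneg by (intro sum_le_suminf) auto
      finally show "sum (\<lambda>p. norm (f (snd p))) F \<le> suminf b" .
    qed
  qed auto
  then have 1: "((\<lambda>p. f (snd p)) has_sum infsum (\<lambda>p. f (snd p)) (Sigma UNIV A)) (Sigma UNIV A)"
    by (rule has_sum_infsum)
  have "((\<lambda>N. \<Sum>x\<in>A N. f x) has_sum infsum (\<lambda>p. f (snd p)) (Sigma UNIV A)) UNIV"
    using fin by (intro has_sum_SigmaD[OF 1]) (auto intro: has_sum_finite)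
  then have "infsum (\<lambda>p. f (snd p)) (Sigma UNIV A) = s"
    using has_sum_imp_sums sums sums_unique2 by blast
  with 1 have "(f has_sum s) (snd ` Sigma UNIV A)"
    by (simp add: has_sum_reindex[OF inj] o_def)
  then show ?thesis unfolding img .
qed

lemma fixed_point_has_sum:
  assumes k: "k \<ge> 1" and L: "L \<in> carrier_mat d d"
    and r: "0 < r" "r < 1"
    and bound: "\<And>n i j. i < d \<Longrightarrow> j < d \<Longrightarrow> \<bar>(L ^\<^sub>m n) $$ (i, j)\<bar> \<le> c * r ^ n"
    and K: "\<And>is. is \<in> multi_indices d k \<Longrightarrow> real k * K is = mode_sum d k L K is + C is"
    and "is": "is \<in> multi_indices d k"
  shows "((\<lambda>ns. multinomial ns * multi_mode_product d k L C ns is / real k ^ Suc (\<Sum>m<k. ns ! m))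
    has_sum K is) {ns. length ns = k}"
proof -
  define B where "B = (\<Sum>js\<in>multi_indices d k. \<bar>C js\<bar>) * c ^ k"
  define f where "f ns =
    multinomial ns * multi_mode_product d k L C ns is / real k ^ Suc (\<Sum>m<k. ns ! m)" for ns
  have f: "f ns = multinomial ns * multi_mode_product d k L C ns is / real k ^ Suc N"
    if "ns \<in> compositions k N" for ns N
    using that by (simp add: f_def compositions_def)
  have "(f has_sum K is) (\<Union>N. compositions k N)"
  proof (rule has_sum_graded)
    show "(\<Sum>ns\<in>compositions k N. \<bar>f ns\<bar>) \<le> B / real k * r ^ N" for N
    proof -
      have "(\<Sum>ns\<in>compositions k N. \<bar>f ns\<bar>) =
          (\<Sum>ns\<in>compositions k N. \<bar>multinomial ns * multi_mode_product d k L C ns is\<bar>)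
            / real k ^ Suc N"
        unfolding sum_divide_distrib by (intro sum.cong refl) (simp add: f abs_divide abs_mult)
      also have "\<dots> \<le> B * r ^ N * real k ^ N / real k ^ Suc N"
        using sum_abs_multi_mode_product_le[OF bound "is", where C = C and N = N]
        unfolding B_def by (intro divide_right_mono) auto
      also have "\<dots> = B / real k * r ^ N" using k by (simp add: field_simps)
      finally show ?thesis .
    qed
    show "summable (\<lambda>N. B / real k * r ^ N)"
      using r by (intro summable_mult summable_geometric) auto
    have "(\<Sum>ns\<in>compositions k N. f ns) = (mode_sum d k L ^^ N) C is / real k ^ Suc N" for N
      unfolding mode_sum_power[OF L "is"] sum_divide_distrib by (intro sum.cong refl f)
    then show "(\<lambda>N. \<Sum>ns\<in>compositions k N. f ns) sums K is"
      using fixed_point_sums[OF k L r bound K "is"] by simp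
  qed (auto simp: finite_compositions, auto simp: compositions_def)
  moreover have "(\<Union>N. compositions k N) = {ns. length ns = k}"
    by (auto simp: compositions_def)
  ultimately show ?thesis by (simp add: f_def[abs_def])
qed

section \<open>Walks, treks and matrix powers\<close>

text \<open>
  The walks with \<open>n\<close> arcs from \<open>j\<close> to \<open>i\<close>. The argument order follows the walk, whereas the
  corresponding matrix entry has index \<open>(i, j)\<close>.
\<close>

definition walks :: "nat pair_pre_digraph \<Rightarrow> nat \<Rightarrow> nat \<Rightarrow> nat \<Rightarrow> (nat \<times> nat) list set" where
  "walks D n j i = {p. pre_digraph.awalk (with_proj D) j p i \<and> length p = n}"

lemma walks_0: "walks D 0 j i = (if j = i \<and> j \<in> pverts D then {[]} else {})"
  by (auto simp: walks_def pre_digraph.awalk_def pre_digraph.cas.simps)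

lemma walks_Suc:
  assumes "pair_wf_digraph D"
  shows "walks D (Suc n) j i = (\<Union>l\<in>{l. (j, l) \<in> parcs D}. (#) (j, l) ` walks D n l i)"
proof -
  interpret pair_wf_digraph D by fact
  show ?thesis
    by (auto simp: walks_def length_Suc_conv awalk_Cons_iff image_iff)
qed

lemma finite_walks_sum:
  fixes L :: "real mat"
  assumes D: "pair_wf_digraph D" "pverts D = {..<d}" and L: "L \<in> carrier_mat d d"
    and zero: "\<And>i j. i < d \<Longrightarrow> j < d \<Longrightarrow> (j, i) \<notin> parcs D \<Longrightarrow> L $$ (i, j) = 0"
    and ij: "i < d" "j < d"
  shows "finite (walks D n j i) \<and>
    (\<Sum>p\<in>walks D n j i. \<Prod>(\<alpha>, \<beta>)\<leftarrow>p. L $$ (\<beta>, \<alpha>)) = (L ^\<^sub>m n) $$ (i, j)"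
  using ij(2)
proof (induction n arbitrary: j)
  case 0
  then show ?case using D ij L by (auto simp: walks_0)
next
  case (Suc n)
  interpret pair_wf_digraph D by fact
  define A where "A = {l. (j, l) \<in> parcs D}"
  have A: "A \<subseteq> {..<d}" using D(2) in_arcsD2 by (auto simp: A_def)
  then have finA: "finite A" by (rule finite_subset) simp
  have fin: "finite ((#) (j, l) ` walks D n l i)" if "l \<in> A" for l
    using Suc.IH[of l] that A by auto
  have W: "walks D (Suc n) j i = (\<Union>l\<in>A. (#) (j, l) ` walks D n l i)"
    unfolding A_def by (rule walks_Suc[OF D(1)])
  have "(\<Sum>p\<in>walks D (Suc n) j i. \<Prod>(\<alpha>, \<beta>)\<leftarrow>p. L $$ (\<beta>, \<alpha>)) =
      (\<Sum>l\<in>A. \<Sum>p\<in>(#) (j, l) ` walks D n l i. \<Prod>(\<alpha>, \<beta>)\<leftarrow>p. L $$ (\<beta>, \<alpha>))"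
    unfolding W using finA fin by (intro sum.UNION_disjoint) auto
  also have "\<dots> = (\<Sum>l\<in>A. L $$ (l, j) * (L ^\<^sub>m n) $$ (i, l))"
  proof (rule sum.cong)
    fix l assume "l \<in> A"
    then have "l < d" using A by auto
    then show "(\<Sum>p\<in>(#) (j, l) ` walks D n l i. \<Prod>(\<alpha>, \<beta>)\<leftarrow>p. L $$ (\<beta>, \<alpha>)) =
        L $$ (l, j) * (L ^\<^sub>m n) $$ (i, l)"
      using Suc.IH[of l] by (simp add: sum.reindex flip: sum_distrib_left)
  qed simp
  also have "\<dots> = (\<Sum>l<d. L $$ (l, j) * (L ^\<^sub>m n) $$ (i, l))"
    using A zero[OF _ Suc.prems] by (intro sum.mono_neutral_left) (auto simp: A_def)
  also have "\<dots> = (L ^\<^sub>m Suc n) $$ (i, j)"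
    using L Suc.prems ij(1) pow_carrier_mat[OF L, of n]
    by (auto simp: scalar_prod_def atLeast0LessThan mult.commute intro!: sum.cong)
  finally show ?case unfolding W using finA fin by auto
qed

lemma sum_prod_lists:
  fixes f :: "nat \<Rightarrow> 'a \<Rightarrow> 'b::comm_semiring_1"
  assumes "\<And>m. m < k \<Longrightarrow> finite (B m)"
  shows "finite {xs. length xs = k \<and> (\<forall>m<k. xs ! m \<in> B m)}"
    and "(\<Sum>xs\<in>{xs. length xs = k \<and> (\<forall>m<k. xs ! m \<in> B m)}. \<Prod>m<k. f m (xs ! m)) =
      (\<Prod>m<k. \<Sum>y\<in>B m. f m y)"
proof -
  let ?X = "{xs. length xs = k \<and> (\<forall>m<k. xs ! m \<in> B m)}"
  have bij: "bij_betw (\<lambda>g. map g [0..<k]) (PiE {..<k} B) ?X"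
  proof (rule bij_betw_byWitness[where f' = "\<lambda>xs. \<lambda>m\<in>{..<k}. xs ! m"])
    show "\<forall>g\<in>PiE {..<k} B. (\<lambda>m\<in>{..<k}. map g [0..<k] ! m) = g"
      by (auto simp: fun_eq_iff PiE_def extensional_def)
    show "\<forall>xs\<in>?X. map (\<lambda>m\<in>{..<k}. xs ! m) [0..<k] = xs"
      by (auto intro: nth_equalityI)
    show "(\<lambda>g. map g [0..<k]) ` PiE {..<k} B \<subseteq> ?X"
      by (simp add: image_subset_iff PiE_iff)
    show "(\<lambda>xs. \<lambda>m\<in>{..<k}. xs ! m) ` ?X \<subseteq> PiE {..<k} B"
      by (simp add: image_subset_iff PiE_iff)
  qed
  have "finite (PiE {..<k} B)" using assms by (intro finite_PiE) auto
  then show "finite ?X" using bij_betw_finite[OF bij] by simp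
  have "(\<Sum>xs\<in>?X. \<Prod>m<k. f m (xs ! m)) =
      (\<Sum>g\<in>PiE {..<k} B. \<Prod>m<k. f m (map g [0..<k] ! m))"
    by (rule sum.reindex_bij_betw[OF bij, symmetric])
  also have "\<dots> = (\<Prod>m<k. \<Sum>y\<in>B m. f m y)"
    using assms by (subst prod_sum_PiE) auto
  finally show "(\<Sum>xs\<in>?X. \<Prod>m<k. f m (xs ! m)) = (\<Prod>m<k. \<Sum>y\<in>B m. f m y)" .
qed

lemma sum_trek_polynomial:
  assumes G: "is_mixed_graph d k G" and L: "L \<in> carrier_mat d d"
    and zero: "\<And>i j. i < d \<Longrightarrow> j < d \<Longrightarrow> (j, i) \<notin> parcs (directed G) \<Longrightarrow> L $$ (i, j) = 0"
    and C: "\<And>js. js \<in> multi_indices d k \<Longrightarrow> mset js \<notin> blunt G \<Longrightarrow> C js = 0"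
    and "is": "is \<in> multi_indices d k"
  shows "(\<Sum>\<tau>\<in>{\<tau> \<in> treks G is. \<forall>m<k. trek_length \<tau> m = ns ! m}. trek_polynomial L C \<tau>) =
    multi_mode_product d k L C ns is"
proof -
  let ?D = "directed G"
  have D: "pair_wf_digraph ?D" "pverts ?D = {..<d}" using G by (auto simp: is_mixed_graph_def)
  \<comment> \<open>The treks with lengths \<open>ns\<close> are the pairs of a top-node list in \<open>J\<close> and a list of walks
    in \<open>P\<close>; dropping the restriction to blunt edges later is harmless since \<open>C\<close> vanishes
    outside them.\<close>
  define J where "J = {js \<in> multi_indices d k. mset js \<in> blunt G}"
  define P where "P js = {ps. length ps = k \<and>
    (\<forall>m<k. ps ! m \<in> walks ?D (ns ! m) (js ! m) (is ! m))}" for js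
  have J: "js \<in> J \<longleftrightarrow> length js = k \<and> mset js \<in> blunt G" for js
  proof -
    have "set_mset (mset js) \<subseteq> {..<d}" "size (mset js) = k" if "mset js \<in> blunt G"
      using G that unfolding is_mixed_graph_def by blast+
    then show ?thesis by (auto simp: J_def multi_indices_def)
  qed
  have lis: "length is = k" using "is" by (simp add: multi_indices_def)
  have treks: "{\<tau> \<in> treks G is. \<forall>m<k. trek_length \<tau> m = ns ! m} = Sigma J P"
    using lis by (auto simp: treks_def J P_def walks_def trek_length_def)
  have W: "finite (walks ?D (ns ! m) (js ! m) (is ! m))"
    "(\<Sum>p\<in>walks ?D (ns ! m) (js ! m) (is ! m). \<Prod>(\<alpha>, \<beta>)\<leftarrow>p. L $$ (\<beta>, \<alpha>)) =
      (L ^\<^sub>m (ns ! m)) $$ (is ! m, js ! m)"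
    if "js \<in> J" "m < k" for js m
    using finite_walks_sum[OF D L zero, of "is ! m" "js ! m" "ns ! m"] that
      multi_indices_nth[OF "is"] multi_indices_nth[of js d k] by (auto simp: J_def)
  have finP: "finite (P js)" if "js \<in> J" for js
    unfolding P_def using W(1)[OF that] by (rule sum_prod_lists(1))
  have "(\<Sum>\<tau>\<in>Sigma J P. trek_polynomial L C \<tau>) =
      (\<Sum>js\<in>J. \<Sum>ps\<in>P js. trek_polynomial L C (js, ps))"
    using finP by (subst sum.Sigma) (auto simp: J_def finite_multi_indices)
  also have "\<dots> = (\<Sum>js\<in>J. C js * (\<Prod>m<k. (L ^\<^sub>m (ns ! m)) $$ (is ! m, js ! m)))"
  proof (rule sum.cong)
    fix js assume js: "js \<in> J"
    have "(\<Sum>ps\<in>P js. trek_polynomial L C (js, ps)) =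
        C js * (\<Sum>ps\<in>P js. \<Prod>m<k. \<Prod>(\<alpha>, \<beta>)\<leftarrow>ps ! m. L $$ (\<beta>, \<alpha>))"
      unfolding sum_distrib_left by (intro sum.cong) (auto simp: trek_polynomial_def P_def)
    also have "(\<Sum>ps\<in>P js. \<Prod>m<k. \<Prod>(\<alpha>, \<beta>)\<leftarrow>ps ! m. L $$ (\<beta>, \<alpha>)) =
        (\<Prod>m<k. (L ^\<^sub>m (ns ! m)) $$ (is ! m, js ! m))"
      unfolding P_def by (subst sum_prod_lists(2)) (auto simp: W js)
    finally show "(\<Sum>ps\<in>P js. trek_polynomial L C (js, ps)) =
        C js * (\<Prod>m<k. (L ^\<^sub>m (ns ! m)) $$ (is ! m, js ! m))" .
  qed simp
  also have "\<dots> = multi_mode_product d k L C ns is"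
    unfolding multi_mode_product_def using C
    by (intro sum.mono_neutral_left) (auto simp: J_def finite_multi_indices)
  finally show ?thesis unfolding treks .
qed

text \<open>
  The Gamma function at \<open>N + 1\<close> is \<open>N!\<close>, so the coefficient of a trek depends only on its walk
  lengths \<open>ns\<close> and is a multinomial coefficient up to a power of \<open>k\<close>.
\<close>

lemma trek_weight_eq_multinomial:
  assumes "length ns = k" "\<And>m. m < k \<Longrightarrow> l m = ns ! m"
  shows "real k powi (- (\<Sum>j<k. int (l j)) - 1) * Gamma (real (\<Sum>j<k. l j) + 1) /
      (\<Prod>j<k. fact (l j)) = multinomial ns / real k ^ Suc (\<Sum>m<k. ns ! m)"
proof -
  let ?N = "\<Sum>m<k. ns ! m"
  have "(- (\<Sum>j<k. int (l j)) - 1) = - int (Suc ?N)"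
    using assms by simp
  then have "real k powi (- (\<Sum>j<k. int (l j)) - 1) = 1 / real k ^ Suc ?N"
    by (simp only: power_int_minus power_int_of_nat inverse_eq_divide)
  moreover have "Gamma (real (\<Sum>j<k. l j) + 1) = fact ?N"
    using assms Gamma_fact[of ?N, where 'a = real] by (simp add: add.commute)
  ultimately show ?thesis using assms by (simp add: multinomial_def)
qed

section \<open>The trek expansion\<close>

theorem propositionB4:
  fixes d k :: nat and G :: mixed_graph and M \<Lambda> :: "real mat" and C :: tensor
  assumes "k \<ge> 1"
    and "is_mixed_graph d k G"
    and "\<forall>v<d. (v, v) \<in> parcs (directed G)"
    and "stable_matrix M"
    and "compatible d k G M C"
    and "\<Lambda> = M + 1\<^sub>m d"
    and "spectral_radius (map_mat complex_of_real \<Lambda>) < 1"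
  shows "(\<exists>K. lyapunov_solution d k M C K) \<and>
    (\<forall>K. lyapunov_solution d k M C K \<longrightarrow>
      (\<forall>is\<in>multi_indices d k.
        ((\<lambda>ns. \<Sum>\<tau>\<in>{\<tau> \<in> treks G is. \<forall>m<k. trek_length \<tau> m = ns ! m}.
            trek_polynomial \<Lambda> C \<tau> *
            (real k powi (- (\<Sum>j<k. int (trek_length \<tau> j)) - 1) *
             Gamma (real (\<Sum>j<k. trek_length \<tau> j) + 1) /
             (\<Prod>j<k. fact (trek_length \<tau> j))))
          has_sum K is) {ns. length ns = k}))"
proof -
  have M: "M \<in> carrier_mat d d" using assms(5) by (simp add: compatible_def)
  then have L: "\<Lambda> \<in> carrier_mat d d" using assms(6) by simp
  have zero: "\<Lambda> $$ (i, j) = 0" if "i < d" "j < d" "(j, i) \<notin> parcs (directed G)" for i j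
    using assms(3,5,6) M that by (auto simp: compatible_def)
  have C: "C js = 0" if "js \<in> multi_indices d k" "mset js \<notin> blunt G" for js
    using assms(5) that by (simp add: compatible_def)
  obtain c r where r: "0 < r" "r < 1"
    and bound: "\<And>n i j. i < d \<Longrightarrow> j < d \<Longrightarrow> \<bar>(\<Lambda> ^\<^sub>m n) $$ (i, j)\<bar> \<le> c * r ^ n"
    using spectral_radius_less_1_geometric_bound[OF L assms(7)] by metis
  note solution_iff = lyapunov_solution_iff[OF M assms(6), of k C]
  show ?thesis
  proof (intro conjI allI impI ballI)
    show "\<exists>K. lyapunov_solution d k M C K"
      using fixed_point_exists[OF assms(1) L r bound, of C] solution_iff by metis
  next
    fix K "is"
    assume K: "lyapunov_solution d k M C K" and "is": "is \<in> multi_indices d k"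
    have "(\<Sum>\<tau>\<in>{\<tau> \<in> treks G is. \<forall>m<k. trek_length \<tau> m = ns ! m}.
            trek_polynomial \<Lambda> C \<tau> *
            (real k powi (- (\<Sum>j<k. int (trek_length \<tau> j)) - 1) *
             Gamma (real (\<Sum>j<k. trek_length \<tau> j) + 1) /
             (\<Prod>j<k. fact (trek_length \<tau> j)))) =
        multinomial ns * multi_mode_product d k \<Lambda> C ns is / real k ^ Suc (\<Sum>m<k. ns ! m)"
      (is "?lhs = _") if ns: "length ns = k" for ns
    proof -
      have "?lhs = (\<Sum>\<tau>\<in>{\<tau> \<in> treks G is. \<forall>m<k. trek_length \<tau> m = ns ! m}.
          trek_polynomial \<Lambda> C \<tau> * (multinomial ns / real k ^ Suc (\<Sum>m<k. ns ! m)))"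
        by (intro sum.cong refl arg_cong2[of _ _ _ _ "(*)"] trek_weight_eq_multinomial ns) auto
      also have "\<dots> = multi_mode_product d k \<Lambda> C ns is *
          (multinomial ns / real k ^ Suc (\<Sum>m<k. ns ! m))"
        unfolding sum_distrib_right[symmetric]
        by (intro arg_cong2[of _ _ _ _ "(*)"] refl sum_trek_polynomial assms(2) L zero C "is")
      finally show ?thesis by simp
    qed
    then show "((\<lambda>ns. \<Sum>\<tau>\<in>{\<tau> \<in> treks G is. \<forall>m<k. trek_length \<tau> m = ns ! m}.
            trek_polynomial \<Lambda> C \<tau> *
            (real k powi (- (\<Sum>j<k. int (trek_length \<tau> j)) - 1) *
             Gamma (real (\<Sum>j<k. trek_length \<tau> j) + 1) /
             (\<Prod>j<k. fact (trek_length \<tau> j))))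
          has_sum K is) {ns. length ns = k}"
      using fixed_point_has_sum[OF assms(1) L r bound _ "is", of K C] K solution_iff
      by (subst has_sum_cong) auto
  qed
qed

end
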